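(* There is an absolute constant $C>0$ such that the following holds. Let $M=(X,d)$ be an $n$-point quasimetric space, $n\ge 2$, and let $\beta>0$. Suppose that for any $r>0$ there exists a $\beta$-Lipschitz distribution over $r$-bounded quasipartitions of $M$. Then $M$ admits an embedding into a convex combination of 0-1 quasimetric spaces with distortion at most $C\beta\log n$.
   Context: A quasimetric space is a pair $(X,d)$ with $d:X\times X\to\mathbb{R}_{\ge 0}\cup\{+\infty\}$, $d(x,y)=0$ iff $x=y$, and $d(x,y)\le d(x,z)+d(z,y)$ (no symmetry required). A quasipartition of $X$ is a reflexive transitive relation $P\subseteq X\times X$; it is $r$-bounded if $(x,y)\in P$ implies $d(x,y)\le r$; a distribution over $r$-bounded quasipartitions is $\beta$-Lipschitz if $\Pr[(x,y)\notin P]\le\beta\,d(x,y)/r$ for all $x,y$. A 0-1 quasimetric on $X$ is $\delta:X\times X\to\{0,1\}$ with $\delta(x,x)=0$ and $\delta(x,y)\le\delta(x,z)+\delta(z,y)$. An embedding into a convex combination of 0-1 quasimetric spaces is a family of 0-1 quasimetrics $\delta_j$ and weights $\alpha_j\ge0$, $\sum_j\alpha_j=1$; with $d_\phi=\sum_j\alpha_j\delta_j$, it has distortion $D$ if there is $\lambda>0$ with $\lambda d(x,y)\le d_\phi(x,y)\le D\lambda d(x,y)$ for all $x,y$.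
   Formalization: The two distortion inequalities are required only for pairs with d(x,y) finite: if some distance is +∞ the claim as stated fails, since d_φ ≤ 1. C is chosen for a fixed ambient set of points; taking the natural numbers covers all finite spaces up to isometry. *)

theory Defs
  imports "HOL-Probability.Probability"
begin

definition quasimetric_on :: "'a set \<Rightarrow> ('a \<Rightarrow> 'a \<Rightarrow> ennreal) \<Rightarrow> bool" where
  "quasimetric_on X d \<longleftrightarrow>
     (\<forall>x\<in>X. \<forall>y\<in>X. d x y = 0 \<longleftrightarrow> x = y) \<and>
     (\<forall>x\<in>X. \<forall>y\<in>X. \<forall>z\<in>X. d x y \<le> d x z + d z y)"

definition quasipartition_of :: "'a set \<Rightarrow> ('a \<times> 'a) set \<Rightarrow> bool" where
  "quasipartition_of X P \<longleftrightarrow> P \<subseteq> X \<times> X \<and> refl_on X P \<and> trans P"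

definition bounded_quasipartition_of ::
  "'a set \<Rightarrow> ('a \<Rightarrow> 'a \<Rightarrow> ennreal) \<Rightarrow> real \<Rightarrow> ('a \<times> 'a) set \<Rightarrow> bool" where
  "bounded_quasipartition_of X d r P \<longleftrightarrow>
     quasipartition_of X P \<and> (\<forall>(x, y)\<in>P. d x y \<le> ennreal r)"

text \<open>A finite set has only finitely many quasipartitions, so a probability mass function is the
  general form of a distribution over them.\<close>

definition lipschitz_quasipartition_pmf ::
  "'a set \<Rightarrow> ('a \<Rightarrow> 'a \<Rightarrow> ennreal) \<Rightarrow> real \<Rightarrow> real \<Rightarrow> ('a \<times> 'a) set pmf \<Rightarrow> bool" where
  "lipschitz_quasipartition_pmf X d \<beta> r p \<longleftrightarrow>
     (\<forall>P\<in>set_pmf p. bounded_quasipartition_of X d r P) \<and>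
     (\<forall>x\<in>X. \<forall>y\<in>X.
        ennreal (measure_pmf.prob p {P. (x, y) \<notin> P}) \<le> ennreal \<beta> * d x y / ennreal r)"

definition zero_one_quasimetric_on :: "'a set \<Rightarrow> ('a \<Rightarrow> 'a \<Rightarrow> real) \<Rightarrow> bool" where
  "zero_one_quasimetric_on X \<delta> \<longleftrightarrow>
     (\<forall>x\<in>X. \<forall>y\<in>X. \<delta> x y \<in> {0, 1}) \<and>
     (\<forall>x\<in>X. \<delta> x x = 0) \<and>
     (\<forall>x\<in>X. \<forall>y\<in>X. \<forall>z\<in>X. \<delta> x y \<le> \<delta> x z + \<delta> z y)"

definition convex_combination_01 ::
  "'a set \<Rightarrow> nat \<Rightarrow> (nat \<Rightarrow> real) \<Rightarrow> (nat \<Rightarrow> 'a \<Rightarrow> 'a \<Rightarrow> real) \<Rightarrow> bool" where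
  "convex_combination_01 X m \<alpha> \<delta> \<longleftrightarrow>
     (\<forall>j<m. zero_one_quasimetric_on X (\<delta> j) \<and> 0 \<le> \<alpha> j) \<and> (\<Sum>j<m. \<alpha> j) = 1"

definition combination_dist ::
  "nat \<Rightarrow> (nat \<Rightarrow> real) \<Rightarrow> (nat \<Rightarrow> 'a \<Rightarrow> 'a \<Rightarrow> real) \<Rightarrow> 'a \<Rightarrow> 'a \<Rightarrow> real" where
  "combination_dist m \<alpha> \<delta> x y = (\<Sum>j<m. \<alpha> j * \<delta> j x y)"

definition has_distortion_on ::
  "('a \<times> 'a) set \<Rightarrow> ('a \<Rightarrow> 'a \<Rightarrow> ennreal) \<Rightarrow> ('a \<Rightarrow> 'a \<Rightarrow> real) \<Rightarrow> real \<Rightarrow> bool" where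
  "has_distortion_on S d d' D \<longleftrightarrow>
     (\<exists>s>0. \<forall>(x, y)\<in>S.
        ennreal s * d x y \<le> ennreal (d' x y) \<and> ennreal (d' x y) \<le> ennreal (D * s) * d x y)"

text \<open>Distortion over all of \<open>X \<times> X\<close> is meaningful only when \<open>d\<close> is finite: the combined
  quasimetric is real-valued, so no finite distortion is possible once some distance is infinite.
  Distortion is therefore measured on the pairs at finite distance, which are all pairs when
  \<open>d\<close> takes no infinite value.\<close>

definition finite_pairs :: "'a set \<Rightarrow> ('a \<Rightarrow> 'a \<Rightarrow> ennreal) \<Rightarrow> ('a \<times> 'a) set" where
  "finite_pairs X d = {(x, y). x \<in> X \<and> y \<in> X \<and> d x y < \<infinity>}"

lemma finite_pairs_eq_Times:
  assumes "\<And>x y. x \<in> X \<Longrightarrow> y \<in> X \<Longrightarrow> d x y < \<infinity>"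
  shows "finite_pairs X d = X \<times> X"
  using assms by (auto simp: finite_pairs_def)

lemma not_has_distortion_on_infinite_dist:
  assumes "x \<in> X" "y \<in> X" "d x y = \<infinity>"
  shows "\<not> has_distortion_on (X \<times> X) d d' D"
  using assms by (force simp: has_distortion_on_def ennreal_mult_top top_unique)

end

theory Submission
  imports Defs
begin

text \<open>Let \<open>n = card X\<close>. If \<open>\<beta> \<le> n\<^sup>2\<close>, a union bound shows that with probability at least \<open>1/2\<close> the
  random \<open>r\<close>-bounded quasipartition contains all pairs at distance at most \<open>r / (2 n\<^sup>4)\<close>, so
  conditioning on this event only doubles the Lipschitz constant. If \<open>\<beta> > n\<^sup>2\<close>, the transitive
  closure of the pairs at distance at most \<open>r / n\<^sup>2\<close> does the same deterministically. Now mix the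
  cut quasimetrics of these quasipartitions over dyadic scales \<open>r\<close> with weights proportional to
  \<open>r\<close>. A pair at distance \<open>d\<close> is always cut at the scales \<open>r < d\<close> and never at the scales
  \<open>r \<ge> 2 n\<^sup>4 d\<close>, and each of the \<open>O(log n)\<close> scales in between contributes \<open>O(\<beta> d)\<close>.\<close>

section \<open>Extended distances and padding\<close>

lemma ennreal_le_times_divide_iff:
  assumes "0 < \<beta>" "0 < r" "0 \<le> a"
  shows "ennreal a \<le> ennreal \<beta> * D / ennreal r \<longleftrightarrow> D = \<infinity> \<or> a \<le> \<beta> * enn2real D / r"
proof (cases D)
  case (real u)
  then show ?thesis
    using assms by (simp add: divide_ennreal flip: ennreal_mult')
next
  case top
  then show ?thesis
    using assms by (simp add: ennreal_mult_top ennreal_top_divide)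
qed

text \<open>At infinite distance the Lipschitz bound is infinite, because \<open>\<beta>\<close> is
  positive, so only real inequalities at finite distance remain.\<close>

lemma lipschitz_quasipartition_pmf_iff:
  assumes "0 < \<beta>" "0 < r"
  shows "lipschitz_quasipartition_pmf X d \<beta> r p \<longleftrightarrow>
     (\<forall>P\<in>set_pmf p. bounded_quasipartition_of X d r P) \<and>
     (\<forall>x\<in>X. \<forall>y\<in>X. d x y < \<infinity> \<longrightarrow>
        measure_pmf.prob p {P. (x, y) \<notin> P} \<le> \<beta> * enn2real (d x y) / r)"
  using assms
  by (simp add: lipschitz_quasipartition_pmf_def ennreal_le_times_divide_iff less_top disj_imp)

text \<open>A deterministic counterpart to boundedness: it makes scales far above a given distance
  contribute nothing to the final sum.\<close>

definition pads :: "'a set \<Rightarrow> ('a \<Rightarrow> 'a \<Rightarrow> ennreal) \<Rightarrow> real \<Rightarrow> ('a \<times> 'a) set \<Rightarrow> bool" where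
  "pads X d t P \<longleftrightarrow> (\<forall>x\<in>X. \<forall>y\<in>X. d x y \<le> ennreal t \<longrightarrow> (x, y) \<in> P)"

lemma pads_mono: "pads X d t P \<Longrightarrow> s \<le> t \<Longrightarrow> pads X d s P"
  unfolding pads_def by (meson ennreal_leI order_trans)

section \<open>Transitive closure of short pairs, for large \<open>\<beta>\<close>\<close>

lemma dist_relpow_le:
  assumes "quasimetric_on X d"
    and "R \<subseteq> X \<times> X" "\<And>x y. (x, y) \<in> R \<Longrightarrow> d x y \<le> e"
    and "(x, y) \<in> R ^^ k" "x \<in> X"
  shows "d x y \<le> of_nat k * e \<and> y \<in> X"
  using assms(4)
proof (induction k arbitrary: y)
  case 0
  then show ?case
    using assms(1,5) by (auto simp: quasimetric_on_def)
next
  case (Suc k)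
  then obtain z where z: "(x, z) \<in> R ^^ k" "(z, y) \<in> R"
    by auto
  have "z \<in> X" "d x z \<le> of_nat k * e"
    using Suc.IH[OF z(1)] by auto
  moreover have "y \<in> X"
    using z(2) assms(2) by auto
  moreover have "d x y \<le> d x z + d z y"
    using assms(1,5) \<open>z \<in> X\<close> \<open>y \<in> X\<close> by (auto simp: quasimetric_on_def)
  moreover have "d z y \<le> e"
    using z(2) assms(3) by auto
  ultimately show ?case
    using add_mono[of "d x z" "of_nat k * e" "d z y" e]
    by (auto simp: algebra_simps intro: order_trans)
qed

text \<open>Related points are joined by a chain of at most \<open>card R\<close>, hence at most
  \<open>card X ^ 2\<close>, steps. Each step costs at most \<open>r / card X ^ 2\<close>, so the
  triangle inequality gives \<open>r\<close>.\<close>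

lemma trancl_bounded_quasipartition:
  fixes X :: "'a set" and d r
  defines "R \<equiv> {(x, y). x \<in> X \<and> y \<in> X \<and> d x y \<le> ennreal (r / real (card X) ^ 2)}"
  assumes fin: "finite X" and qm: "quasimetric_on X d" and "0 < r"
  shows "bounded_quasipartition_of X d r (R\<^sup>+)"
proof -
  have R: "R \<subseteq> X \<times> X"
    by (auto simp: R_def)
  have finR: "finite R"
    using finite_subset[OF R] fin by simp
  have cardR: "card R \<le> card X ^ 2"
    using card_mono[OF _ R] fin by (simp add: card_cartesian_product power2_eq_square)
  have "quasipartition_of X (R\<^sup>+)"
    unfolding quasipartition_of_def
  proof (intro conjI)
    show sub: "R\<^sup>+ \<subseteq> X \<times> X"
      using R by (rule trancl_subset_Sigma)
    have "(x, x) \<in> R" if "x \<in> X" for x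
      using that qm by (force simp: R_def quasimetric_on_def)
    then show "refl_on X (R\<^sup>+)"
      by (auto simp: refl_on_def)
  qed simp
  moreover have "d x y \<le> ennreal r" if xy: "(x, y) \<in> R\<^sup>+" for x y
  proof -
    \<comment> \<open>The chain length is bounded by the number of edges, which is where the square
      of \<open>card X\<close> in the threshold comes from.\<close>
    obtain k where k: "0 < k" "k \<le> card R" "(x, y) \<in> R ^^ k"
      using xy by (auto simp: trancl_finite_eq_relpow[OF finR])
    have "x \<in> X"
      using trancl_subset_Sigma[OF R] xy by auto
    then have "d x y \<le> of_nat k * ennreal (r / real (card X) ^ 2)"
      using dist_relpow_le[OF qm R _ k(3)] by (auto simp: R_def)
    also have "\<dots> = ennreal (real k * (r / real (card X) ^ 2))"
      by (simp only: ennreal_mult' ennreal_of_nat_eq_real_of_nat of_nat_0_le_iff)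
    also have "\<dots> \<le> ennreal r"
    proof (rule ennreal_leI)
      have "real k \<le> real (card X) ^ 2"
        using k(2) cardR by (metis of_nat_le_iff of_nat_power order_trans)
      moreover have "card X > 0"
        using \<open>x \<in> X\<close> fin by (auto simp: card_gt_0_iff)
      ultimately show "real k * (r / real (card X) ^ 2) \<le> r"
        using \<open>0 < r\<close> by (simp add: field_simps)
    qed
    finally show ?thesis .
  qed
  ultimately show ?thesis
    by (auto simp: bounded_quasipartition_of_def)
qed

text \<open>The point mass on the transitive closure works: a cut pair is at distance above
  \<open>r / card X ^ 2\<close>, where the Lipschitz bound is already at least 1.\<close>

lemma padded_lipschitz_large:
  assumes fin: "finite X" "X \<noteq> {}" and qm: "quasimetric_on X d" and "0 < r"
    and \<beta>: "real (card X) ^ 2 \<le> \<beta>"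
  shows "\<exists>p. lipschitz_quasipartition_pmf X d \<beta> r p \<and>
             (\<forall>P\<in>set_pmf p. pads X d (r / real (card X) ^ 2) P)"
proof -
  define R where
    "R = {(x, y). x \<in> X \<and> y \<in> X \<and> d x y \<le> ennreal (r / real (card X) ^ 2)}"
  have n: "0 < real (card X)"
    using fin by (simp add: card_gt_0_iff)
  then have "0 < real (card X) ^ 2"
    by simp
  then have "0 < \<beta>"
    using \<beta> by linarith
  have "measure_pmf.prob (return_pmf (R\<^sup>+)) {P. (x, y) \<notin> P} \<le> \<beta> * enn2real (d x y) / r"
    if xy: "x \<in> X" "y \<in> X" "d x y < \<infinity>" for x y
  proof (cases "(x, y) \<in> R\<^sup>+")
    case True
    then show ?thesis
      using \<open>0 < \<beta>\<close> \<open>0 < r\<close> by simp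
  next
    case False
    then have "ennreal (r / real (card X) ^ 2) < d x y"
      using xy by (force simp: R_def not_le)
    then have "r / real (card X) ^ 2 \<le> enn2real (d x y)"
      using xy(3) \<open>0 < r\<close> by (cases "d x y") (auto simp: ennreal_less_iff)
    then have "r \<le> real (card X) ^ 2 * enn2real (d x y)"
      using n by (simp add: field_simps)
    also have "\<dots> \<le> \<beta> * enn2real (d x y)"
      using \<beta> by (intro mult_right_mono) auto
    finally show ?thesis
      using False \<open>0 < r\<close> by simp
  qed
  moreover have "pads X d (r / real (card X) ^ 2) (R\<^sup>+)"
    by (auto simp: pads_def R_def)
  ultimately show ?thesis
    using trancl_bounded_quasipartition[OF fin(1) qm \<open>0 < r\<close>] \<open>0 < \<beta>\<close> \<open>0 < r\<close>
    by (intro exI[of _ "return_pmf (R\<^sup>+)"])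
       (simp add: lipschitz_quasipartition_pmf_iff R_def)
qed

section \<open>Conditioning on padding, for small \<open>\<beta>\<close>\<close>

lemma prob_cond_pmf_le:
  assumes A: "1 / 2 \<le> measure_pmf.prob p A"
  shows "measure_pmf.prob (cond_pmf p A) B \<le> 2 * measure_pmf.prob p B"
proof -
  have ne: "set_pmf p \<inter> A \<noteq> {}"
    using A by (force simp flip: measure_pmf_zero_iff)
  have "measure_pmf.prob (cond_pmf p A) B = measure_pmf.prob p (A \<inter> B) / measure_pmf.prob p A"
    using A by (simp add: cond_pmf.rep_eq[OF ne] measure_pmf.measure_uniform_measure_eq_cond_prob
        measure_pmf.emeasure_eq_measure cond_prob_def Int_def conj_commute)
  also have "\<dots> \<le> measure_pmf.prob p B / (1 / 2)"
    using A by (intro frac_le measure_pmf.finite_measure_mono) auto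
  finally show ?thesis
    by simp
qed

text \<open>At most \<open>card X ^ 2\<close> pairs lie within distance \<open>t\<close>, and each
  is cut with probability at most \<open>\<beta> * t / r\<close>. By the union bound padding fails
  with probability at most 1/2. Conditioning on padding only shrinks the support, so boundedness
  survives.\<close>

lemma padded_lipschitz_small:
  assumes fin: "finite X" and "0 < r" "0 < \<beta>" "0 \<le> t"
    and \<beta>: "real (card X) ^ 2 * (\<beta> * t) \<le> r / 2"
    and p: "lipschitz_quasipartition_pmf X d \<beta> r p"
  shows "\<exists>p. lipschitz_quasipartition_pmf X d (2 * \<beta>) r p \<and> (\<forall>P\<in>set_pmf p. pads X d t P)"
proof -
  define S where "S = {(x, y). x \<in> X \<and> y \<in> X \<and> d x y \<le> ennreal t}"
  define A where "A = {P. pads X d t P}"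
  have S: "S \<subseteq> X \<times> X"
    by (auto simp: S_def)
  then have finS: "finite S"
    using fin finite_subset by blast
  have "card S \<le> card X ^ 2"
    using card_mono[OF _ S] fin by (simp add: card_cartesian_product power2_eq_square)
  then have cardS: "real (card S) \<le> real (card X) ^ 2"
    by (metis of_nat_le_iff of_nat_power)
  have bnd: "measure_pmf.prob p {P. (x, y) \<notin> P} \<le> \<beta> * enn2real (d x y) / r"
    if "x \<in> X" "y \<in> X" "d x y < \<infinity>" for x y
    using p that assms(2,3) by (simp add: lipschitz_quasipartition_pmf_iff)
  have "- A = (\<Union>z\<in>S. {P. z \<notin> P})"
    by (auto simp: A_def S_def pads_def)
  then have "measure_pmf.prob p (- A) \<le> (\<Sum>z\<in>S. measure_pmf.prob p {P. z \<notin> P})"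
    using measure_pmf.finite_measure_subadditive_finite[OF finS, of "\<lambda>z. {P. z \<notin> P}" p] by simp
  also have "\<dots> \<le> (\<Sum>z\<in>S. \<beta> * t / r)"
  proof (rule sum_mono)
    fix z assume "z \<in> S"
    then obtain x y where z: "z = (x, y)" "x \<in> X" "y \<in> X" "d x y \<le> ennreal t"
      by (auto simp: S_def)
    then have "d x y < \<infinity>" "enn2real (d x y) \<le> t"
      using \<open>0 \<le> t\<close> by (auto simp: enn2real_leI intro: le_less_trans)
    then have "\<beta> * enn2real (d x y) / r \<le> \<beta> * t / r"
      using assms(2,3) by (intro divide_right_mono mult_left_mono) auto
    with bnd[OF z(2,3) \<open>d x y < \<infinity>\<close>] z(1)
    show "measure_pmf.prob p {P. z \<notin> P} \<le> \<beta> * t / r"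
      by simp
  qed
  also have "\<dots> = real (card S) * (\<beta> * t) / r"
    by simp
  also have "\<dots> \<le> real (card X) ^ 2 * (\<beta> * t) / r"
    using cardS assms(2-4) by (intro divide_right_mono mult_right_mono) auto
  also have "\<dots> \<le> 1 / 2"
    using \<beta> \<open>0 < r\<close> by (simp add: field_simps)
  finally have A: "1 / 2 \<le> measure_pmf.prob p A"
    using measure_pmf.prob_compl[of A p] by (simp add: Compl_eq_Diff_UNIV)
  then have ne: "set_pmf p \<inter> A \<noteq> {}"
    by (force simp flip: measure_pmf_zero_iff)
  have "measure_pmf.prob (cond_pmf p A) {P. (x, y) \<notin> P} \<le> 2 * \<beta> * enn2real (d x y) / r"
    if "x \<in> X" "y \<in> X" "d x y < \<infinity>" for x y
    using prob_cond_pmf_le[OF A, of "{P. (x, y) \<notin> P}"] bnd[OF that] by simp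
  moreover have "bounded_quasipartition_of X d r P" "pads X d t P"
    if "P \<in> set_pmf (cond_pmf p A)" for P
    using that p set_cond_pmf[OF ne] by (auto simp: A_def lipschitz_quasipartition_pmf_def)
  ultimately show ?thesis
    using assms(2,3)
    by (intro exI[of _ "cond_pmf p A"]) (simp add: lipschitz_quasipartition_pmf_iff)
qed

text \<open>The fourth power is the square from counting pairs times the square bounding
  \<open>\<beta>\<close> in the first case.\<close>

lemma padded_lipschitz:
  assumes fin: "finite X" "X \<noteq> {}" and qm: "quasimetric_on X d" and "0 < r" "0 < \<beta>"
    and p: "lipschitz_quasipartition_pmf X d \<beta> r p"
  shows "\<exists>p. lipschitz_quasipartition_pmf X d (2 * \<beta>) r p \<and>
             (\<forall>P\<in>set_pmf p. pads X d (r / (2 * real (card X) ^ 4)) P)"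
proof (cases "\<beta> \<le> real (card X) ^ 2")
  case True
  have n: "0 < real (card X)"
    using fin by (simp add: card_gt_0_iff)
  have "real (card X) ^ 2 * (\<beta> * (r / (2 * real (card X) ^ 4))) =
      (\<beta> / real (card X) ^ 2) * (r / 2)"
    using n by (simp add: field_simps power4_eq_xxxx power2_eq_square)
  also have "\<dots> \<le> 1 * (r / 2)"
    using True n \<open>0 < r\<close> by (intro mult_right_mono) (auto simp: field_simps)
  finally show ?thesis
    using padded_lipschitz_small[OF fin(1) \<open>0 < r\<close> \<open>0 < \<beta>\<close> _ _ p] \<open>0 < r\<close> by simp
next
  case False
  have n: "1 \<le> real (card X)"
    using fin by (simp add: Suc_le_eq card_gt_0_iff)
  have "real (card X) ^ 2 * 1 \<le> real (card X) ^ 2 * (2 * real (card X) ^ 2)"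
    using one_le_power[OF n, of 2] by (intro mult_left_mono) auto
  then have "real (card X) ^ 2 \<le> 2 * real (card X) ^ 4"
    by (simp add: power4_eq_xxxx power2_eq_square mult_ac)
  then have "r / (2 * real (card X) ^ 4) \<le> r / real (card X) ^ 2"
    using n \<open>0 < r\<close> by (intro divide_left_mono) auto
  \<comment> \<open>The closure construction is applied with constant \<open>2 * \<beta>\<close>, so
    that both cases end with the same constant.\<close>
  moreover have "\<exists>p. lipschitz_quasipartition_pmf X d (2 * \<beta>) r p \<and>
             (\<forall>P\<in>set_pmf p. pads X d (r / real (card X) ^ 2) P)"
    using False \<open>0 < \<beta>\<close> by (intro padded_lipschitz_large[OF fin qm \<open>0 < r\<close>]) simp
  ultimately show ?thesis
    using pads_mono by blast
qed

section \<open>Cut quasimetrics and their mixtures\<close>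

lemma zero_one_quasimetric_on_indicator:
  assumes "quasipartition_of X P"
  shows "zero_one_quasimetric_on X (\<lambda>x y. of_bool ((x, y) \<notin> P))"
  \<comment> \<open>The triangle inequality is transitivity read contrapositively: if
    \<open>(x, y)\<close> is cut, so is one of the two legs through \<open>z\<close>.\<close>
  using assms
  by (auto simp: zero_one_quasimetric_on_def quasipartition_of_def refl_on_def dest: transD)

lemma convex_combination_01_of_finite:
  assumes "finite I" "\<And>i. i \<in> I \<Longrightarrow> zero_one_quasimetric_on X (\<delta> i)"
    and "\<And>i. i \<in> I \<Longrightarrow> 0 \<le> \<alpha> i" "sum \<alpha> I = 1"
  shows "\<exists>m \<alpha>' \<delta>'. convex_combination_01 X m \<alpha>' \<delta>' \<and>
           (\<forall>x y. combination_dist m \<alpha>' \<delta>' x y = (\<Sum>i\<in>I. \<alpha> i * \<delta> i x y))"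
proof -
  obtain h where h: "bij_betw h {..<card I} I"
    using ex_bij_betw_nat_finite[OF assms(1)] by (auto simp: atLeast0LessThan)
  then have "h j \<in> I" if "j < card I" for j
    using that by (auto simp: bij_betw_def)
  then have "convex_combination_01 X (card I) (\<alpha> \<circ> h) (\<delta> \<circ> h)"
    using assms(2-4) sum.reindex_bij_betw[OF h, of \<alpha>]
    by (simp add: convex_combination_01_def)
  moreover have "combination_dist (card I) (\<alpha> \<circ> h) (\<delta> \<circ> h) x y = (\<Sum>i\<in>I. \<alpha> i * \<delta> i x y)" for x y
    using sum.reindex_bij_betw[OF h, of "\<lambda>i. \<alpha> i * \<delta> i x y"]
    by (simp add: combination_dist_def)
  ultimately show ?thesis
    by blast
qed

text \<open>The summands are indexed by pairs of a scale and a quasipartition, weighted by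
  \<open>w k * pmf (p k) P\<close>. The index set is finite because a finite \<open>X\<close> has
  finitely many quasipartitions.\<close>

lemma convex_combination_01_of_pmfs:
  fixes p :: "nat \<Rightarrow> ('a \<times> 'a) set pmf"
  assumes fin: "finite X"
    and p: "\<And>k P. k < K \<Longrightarrow> P \<in> set_pmf (p k) \<Longrightarrow> quasipartition_of X P"
    and w: "\<And>k. k < K \<Longrightarrow> 0 \<le> w k" "(\<Sum>k<K. w k) = 1"
  shows "\<exists>m \<alpha> \<delta>. convex_combination_01 X m \<alpha> \<delta> \<and>
           (\<forall>x y. combination_dist m \<alpha> \<delta> x y =
              (\<Sum>k<K. w k * measure_pmf.prob (p k) {P. (x, y) \<notin> P}))"
proof -
  define Q where "Q = {P. quasipartition_of X P}"
  have "Q \<subseteq> Pow (X \<times> X)"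
    by (auto simp: Q_def quasipartition_of_def)
  then have finQ: "finite Q"
    using fin finite_subset by (metis finite_Pow_iff finite_cartesian_product)
  have prob: "measure_pmf.prob (p k) A = (\<Sum>P\<in>Q. pmf (p k) P * of_bool (P \<in> A))"
    if "k < K" for k A
  proof -
    have "measure_pmf.prob (p k) A = measure_pmf.prob (p k) (A \<inter> Q)"
      using p[OF that] by (intro measure_prob_cong_0) (auto simp: Q_def set_pmf_iff)
    also have "\<dots> = (\<Sum>P\<in>A \<inter> Q. pmf (p k) P)"
      using finQ by (simp add: measure_measure_pmf_finite)
    also have "\<dots> = (\<Sum>P\<in>Q. pmf (p k) P * of_bool (P \<in> A))"
      using finQ by (intro sum.mono_neutral_cong_left) auto
    finally show ?thesis .
  qed
  let ?I = "{..<K} \<times> Q"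
  let ?\<alpha> = "\<lambda>(k, P). w k * pmf (p k) P"
  let ?\<delta> = "\<lambda>(k, P) x y. of_bool ((x, y) \<notin> P) :: real"
  have "sum ?\<alpha> ?I = (\<Sum>k<K. w k * (\<Sum>P\<in>Q. pmf (p k) P))"
    by (simp add: sum.cartesian_product[symmetric] sum_distrib_left)
  also have "\<dots> = 1"
    \<comment> \<open>For the event \<open>UNIV\<close>, \<open>prob\<close> says that the masses
      over \<open>Q\<close> sum to 1.\<close>
    using prob[of _ UNIV] w(2) by simp
  finally have "sum ?\<alpha> ?I = 1" .
  moreover have "(\<Sum>i\<in>?I. ?\<alpha> i * ?\<delta> i x y) =
      (\<Sum>k<K. w k * measure_pmf.prob (p k) {P. (x, y) \<notin> P})" for x y
    using prob[of _ "{P. (x, y) \<notin> P}"]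
    by (simp add: sum.cartesian_product' sum_distrib_left mult.assoc)
  moreover have "zero_one_quasimetric_on X (?\<delta> i)" "0 \<le> ?\<alpha> i" if "i \<in> ?I" for i
    using that w(1) zero_one_quasimetric_on_indicator by (auto simp: Q_def)
  ultimately show ?thesis
    using convex_combination_01_of_finite[of ?I X ?\<delta> ?\<alpha>] finQ by simp
qed

section \<open>Summation over dyadic scales\<close>

lemma dyadic_scale:
  fixes a u :: real
  assumes "0 < a" "a < u"
  obtains k where "a * 2 ^ k < u" "u \<le> a * 2 ^ Suc k"
proof -
  define k where "k = (LEAST k. u \<le> a * 2 ^ k)"
  obtain j where "u / a < 2 ^ j"
    using real_arch_pow[of 2 "u / a"] by auto
  then have "u \<le> a * 2 ^ j"
    using assms by (simp add: field_simps)
  then have k: "u \<le> a * 2 ^ k"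
    unfolding k_def by (rule LeastI)
  with assms have "k \<noteq> 0"
    by (intro notI) simp
  then obtain i where i: "k = Suc i"
    using not0_implies_Suc by blast
  then have "\<not> u \<le> a * 2 ^ i"
    using not_less_Least[of i "\<lambda>k. u \<le> a * 2 ^ k"] by (simp flip: k_def)
  then show ?thesis
    using that[of i] k i by simp
qed

text \<open>Let \<open>k\<close> be the last scale with \<open>a * 2 ^ k < u\<close>. Its term alone
  is at least \<open>u / 2\<close>. From above, the scales up to \<open>k\<close> form a geometric
  sum below \<open>2 * b * u\<close>, the next \<open>N\<close> scales give at most
  \<open>b * u\<close> each, and all later ones vanish.\<close>

lemma multiscale_sum_bounds:
  fixes q :: "nat \<Rightarrow> real"
  assumes "0 < a" "a < u" "u \<le> a * 2 ^ K"
    and nonneg: "\<And>k. 0 \<le> q k"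
    and le: "\<And>k. k < K \<Longrightarrow> q k \<le> b * u / (a * 2 ^ k)"
    and one: "\<And>k. k < K \<Longrightarrow> a * 2 ^ k < u \<Longrightarrow> q k = 1"
    and zero: "\<And>k. k < K \<Longrightarrow> 2 ^ N * u \<le> a * 2 ^ k \<Longrightarrow> q k = 0"
  shows "u / 2 \<le> (\<Sum>k<K. a * 2 ^ k * q k)"
    and "(\<Sum>k<K. a * 2 ^ k * q k) \<le> (2 + real N) * b * u"
proof -
  obtain k where k: "a * 2 ^ k < u" "u \<le> a * 2 ^ Suc k"
    using dyadic_scale[OF assms(1,2)] .
  have "a * 2 ^ k < a * 2 ^ K"
    using k(1) assms(3) by linarith
  then have kK: "k < K"
    using \<open>0 < a\<close> by simp
  have "u / 2 \<le> a * 2 ^ k * q k"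
    using k one[OF kK k(1)] by simp
  also have "\<dots> \<le> (\<Sum>k<K. a * 2 ^ k * q k)"
    using kK nonneg \<open>0 < a\<close> by (intro member_le_sum) auto
  finally show "u / 2 \<le> (\<Sum>k<K. a * 2 ^ k * q k)" .

  \<comment> \<open>Reading \<open>le\<close> at the scale \<open>k\<close>, where
    \<open>q k = 1\<close>, gives the small scales the same factor \<open>b * u\<close> as the
    middle ones.\<close>
  have bu: "a * 2 ^ k \<le> b * u"
    using le[OF kK] one[OF kK k(1)] \<open>0 < a\<close> by (simp add: field_simps)
  then have bu0: "0 \<le> b * u"
    using \<open>0 < a\<close> by (meson mult_nonneg_nonneg less_imp_le order_trans zero_le_numeral zero_le_power)
  \<comment> \<open>Padding the sum with zeros past both \<open>K\<close> and
    \<open>Suc (k + N)\<close> avoids a case distinction on which is larger.\<close>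
  have "(\<Sum>j<K. a * 2 ^ j * q j) \<le> (\<Sum>j<K + Suc (k + N). a * 2 ^ j * (if j < K then q j else 0))"
  proof -
    have "(\<Sum>j<K. a * 2 ^ j * q j) = (\<Sum>j<K. a * 2 ^ j * (if j < K then q j else 0))"
      by (intro sum.cong) auto
    also have "\<dots> \<le> (\<Sum>j<K + Suc (k + N). a * 2 ^ j * (if j < K then q j else 0))"
      using nonneg \<open>0 < a\<close> by (intro sum_mono2) auto
    finally show ?thesis .
  qed
  also have "\<dots> = (\<Sum>j<Suc (k + N). a * 2 ^ j * (if j < K then q j else 0))"
  proof (rule sum.mono_neutral_right)
    show "\<forall>j\<in>{..<K + Suc (k + N)} - {..<Suc (k + N)}. a * 2 ^ j * (if j < K then q j else 0) = 0"
    proof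
      fix j assume j: "j \<in> {..<K + Suc (k + N)} - {..<Suc (k + N)}"
      then have "(2::real) ^ (Suc k + N) \<le> 2 ^ j"
        by (intro power_increasing) auto
      then have "2 ^ N * (a * 2 ^ Suc k) \<le> a * 2 ^ j"
        using \<open>0 < a\<close> by (simp add: power_add mult_ac)
      moreover have "2 ^ N * u \<le> 2 ^ N * (a * 2 ^ Suc k)"
        using k(2) by (intro mult_left_mono) auto
      ultimately have "2 ^ N * u \<le> a * 2 ^ j"
        by linarith
      then show "a * 2 ^ j * (if j < K then q j else 0) = 0"
        using zero[of j] by simp
    qed
  qed auto
  also have "\<dots> = (\<Sum>j<Suc k. a * 2 ^ j * (if j < K then q j else 0)) +
      (\<Sum>j=Suc k..<Suc k + N. a * 2 ^ j * (if j < K then q j else 0))"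
    using sum.atLeastLessThan_concat[of 0 "Suc k" "Suc k + N"
        "\<lambda>j. a * 2 ^ j * (if j < K then q j else 0)"]
    by (simp only: atLeast0LessThan add_Suc)
  also have "\<dots> \<le> (\<Sum>j<Suc k. a * 2 ^ j) + (\<Sum>j=Suc k..<Suc k + N. b * u)"
  proof (intro add_mono sum_mono)
    fix j assume "j \<in> {..<Suc k}"
    then have "j < K" "a * 2 ^ j \<le> a * 2 ^ k"
      using kK \<open>0 < a\<close> by auto
    then show "a * 2 ^ j * (if j < K then q j else 0) \<le> a * 2 ^ j"
      using one[of j] k(1) by simp
  next
    fix j
    show "a * 2 ^ j * (if j < K then q j else 0) \<le> b * u"
      using le[of j] bu0 \<open>0 < a\<close> by (simp add: field_simps)
  qed
  also have "(\<Sum>j<Suc k. a * 2 ^ j) = a * (2 ^ Suc k - 1)"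
    using geometric_sum[of "2 :: real" "Suc k"] by (simp only: sum_distrib_left[symmetric]) simp
  also have "\<dots> \<le> 2 * (b * u)"
    using bu \<open>0 < a\<close> by (simp add: algebra_simps)
  finally show "(\<Sum>k<K. a * 2 ^ k * q k) \<le> (2 + real N) * b * u"
    by (simp add: algebra_simps)
qed

text \<open>Since \<open>n\<close> is at least 2, \<open>2 * n ^ 4 \<le> n ^ 5\<close>, which gives
  the 5 in \<open>N\<close>. Rounding up and adding 2 costs at most 3, absorbed as
  \<open>3 * log 2 n\<close> because \<open>log 2 n\<close> is at least 1; hence 8.\<close>

lemma exists_log_exponent:
  assumes "2 \<le> n"
  obtains N where "2 * real n ^ 4 \<le> 2 ^ N" "2 + real N \<le> 8 / ln 2 * ln (real n)"
proof -
  define N where "N = nat \<lceil>5 * log 2 (real n)\<rceil>"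
  have n: "2 \<le> real n"
    using assms by simp
  have L: "1 \<le> log 2 (real n)"
    using n by simp
  have "2 * real n ^ 4 \<le> real n ^ 5"
    using n by (simp add: eval_nat_numeral)
  also have "\<dots> = (2 powr log 2 (real n)) powr 5"
    using n by simp
  also have "\<dots> = 2 powr (5 * log 2 (real n))"
    by (simp only: powr_powr mult.commute)
  also have "\<dots> \<le> 2 powr (real N)"
    using L by (simp add: N_def)
  finally have "2 * real n ^ 4 \<le> 2 ^ N"
    by (simp add: powr_realpow)
  moreover have "2 + real N \<le> 8 * log 2 (real n)"
    using L unfolding N_def by linarith
  then have "2 + real N \<le> 8 / ln 2 * ln (real n)"
    by (simp add: log_def)
  ultimately show ?thesis
    using that by blast
qed

section \<open>Assembly of the embedding\<close>

theorem theorem17: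
  shows "\<exists>C>0. \<forall>(X :: 'a set) (d :: 'a \<Rightarrow> 'a \<Rightarrow> ennreal) (\<beta> :: real).
    finite X \<and> card X \<ge> 2 \<and> quasimetric_on X d \<and> \<beta> > 0 \<and>
    (\<forall>r>0. \<exists>p. lipschitz_quasipartition_pmf X d \<beta> r p) \<longrightarrow>
    (\<exists>m \<alpha> \<delta> D. convex_combination_01 X m \<alpha> \<delta> \<and>
       D \<le> C * \<beta> * ln (real (card X)) \<and>
       has_distortion_on (finite_pairs X d) d (combination_dist m \<alpha> \<delta>) D)"
proof (intro exI[of _ "32 / ln 2"] conjI allI impI; (elim conjE)?)
  fix X :: "'a set" and d :: "'a \<Rightarrow> 'a \<Rightarrow> ennreal" and \<beta> :: real
  assume fin: "finite X" and card: "2 \<le> card X" and qm: "quasimetric_on X d" and "0 < \<beta>"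
    and ex: "\<forall>r>0. \<exists>p. lipschitz_quasipartition_pmf X d \<beta> r p"
  have ne: "X \<noteq> {}"
    using card by auto
  obtain N where N: "2 * real (card X) ^ 4 \<le> 2 ^ N"
      "2 + real N \<le> 8 / ln 2 * ln (real (card X))"
    using exists_log_exponent[OF card] .
  define F where "F = {enn2real (d x y) | x y. (x, y) \<in> finite_pairs X d \<and> x \<noteq> y}"
  have "F \<subseteq> (\<lambda>(x, y). enn2real (d x y)) ` (X \<times> X)"
    by (auto simp: F_def finite_pairs_def)
  then have finF: "finite F"
    using fin finite_subset by blast
  have Fpos: "0 < u" if "u \<in> F" for u
    using that qm
    by (auto simp: F_def finite_pairs_def quasimetric_on_def enn2real_positive_iff zero_less_iff_neq_zero)
  \<comment> \<open>Inserting 1 keeps the minimum defined when all distinct points are at infinite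
    distance; halving puts \<open>a\<close> strictly below every distance in
    \<open>F\<close>.\<close>
  define a where "a = Min (insert 1 F) / 2"
  have a: "0 < a" "\<And>u. u \<in> F \<Longrightarrow> a < u"
  proof -
    have pos: "0 < Min (insert 1 F)"
      using finF Fpos by simp
    then show "0 < a"
      by (simp add: a_def)
    show "a < u" if "u \<in> F" for u
    proof -
      have "Min (insert 1 F) \<le> u"
        using finF that by (intro Min_le) auto
      then show ?thesis
        using pos unfolding a_def by linarith
    qed
  qed
  obtain K0 where K0: "Max (insert 1 F) / a < 2 ^ K0"
    using real_arch_pow[of 2] by (metis one_less_numeral_iff semiring_norm(76))
  \<comment> \<open>The successor makes the range of scales visibly nonempty, as positivity of the
    normalising sum \<open>S\<close> requires.\<close>
  define K where "K = Suc K0"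
  have K: "u \<le> a * 2 ^ K" if "u \<in> F" for u
  proof -
    have "u \<le> Max (insert 1 F)"
      using finF that by simp
    also have "\<dots> \<le> a * 2 ^ K0"
      using K0 a(1) by (simp add: field_simps)
    also have "\<dots> \<le> a * 2 ^ K"
      using a(1) by (simp add: K_def)
    finally show ?thesis .
  qed
  have "\<exists>p. lipschitz_quasipartition_pmf X d (2 * \<beta>) (a * 2 ^ k) p \<and>
             (\<forall>P\<in>set_pmf p. pads X d (a * 2 ^ k / (2 * real (card X) ^ 4)) P)" for k :: nat
  proof -
    have r: "0 < a * 2 ^ k"
      using a(1) by simp
    with ex obtain p where "lipschitz_quasipartition_pmf X d \<beta> (a * 2 ^ k) p"
      by blast
    then show ?thesis
      by (rule padded_lipschitz[OF fin ne qm r \<open>0 < \<beta>\<close>])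
  qed
  then obtain p where
    lip: "lipschitz_quasipartition_pmf X d (2 * \<beta>) (a * 2 ^ k) (p k)" and
    pad: "P \<in> set_pmf (p k) \<Longrightarrow> pads X d (a * 2 ^ k / (2 * real (card X) ^ 4)) P" for k P
    by metis
  have bdd: "bounded_quasipartition_of X d (a * 2 ^ k) P" if "P \<in> set_pmf (p k)" for k P
    using lip that by (auto simp: lipschitz_quasipartition_pmf_def)
  define q where "q k x y = measure_pmf.prob (p k) {P. (x, y) \<notin> P}" for k x y
  define S where "S = (\<Sum>k<K. a * 2 ^ k)"
  have S: "0 < S"
    using a(1) unfolding S_def K_def by (intro sum_pos) auto
  have "(\<Sum>k<K. a * 2 ^ k / S) = 1"
    using S by (simp add: S_def flip: sum_divide_distrib)
  then obtain m \<alpha> \<delta> where cc: "convex_combination_01 X m \<alpha> \<delta>"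
    and cd: "\<And>x y. combination_dist m \<alpha> \<delta> x y = (\<Sum>k<K. a * 2 ^ k / S * q k x y)"
    using convex_combination_01_of_pmfs[OF fin, of K p "\<lambda>k. a * 2 ^ k / S"] bdd a(1) S
    unfolding q_def by (auto simp: bounded_quasipartition_of_def)
  have cd': "combination_dist m \<alpha> \<delta> x y = (\<Sum>k<K. a * 2 ^ k * q k x y) / S" for x y
    by (simp add: cd sum_divide_distrib)
  \<comment> \<open>These are the bounds before division by \<open>S\<close>. The diagonal is
    treated apart because the dyadic argument needs a distance above \<open>a\<close>.\<close>
  have main: "enn2real (d x y) / 2 \<le> (\<Sum>k<K. a * 2 ^ k * q k x y) \<and>
      (\<Sum>k<K. a * 2 ^ k * q k x y) \<le> (2 + real N) * (2 * \<beta>) * enn2real (d x y)"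
    if xy: "(x, y) \<in> finite_pairs X d" for x y
  proof (cases "x = y")
    case True
    have X: "x \<in> X" "y \<in> X"
      using xy by (auto simp: finite_pairs_def)
    then have "d x y = 0"
      using qm True by (auto simp: quasimetric_on_def)
    moreover have "q k x y = 0" for k
      using bdd[of _ k] X True
      by (auto simp: q_def measure_pmf_zero_iff bounded_quasipartition_of_def
          quasipartition_of_def refl_on_def)
    ultimately show ?thesis
      by simp
  next
    case False
    define u where "u = enn2real (d x y)"
    have X: "x \<in> X" "y \<in> X" "d x y = ennreal u"
      using xy by (auto simp: finite_pairs_def u_def)
    have uF: "u \<in> F"
      using xy False by (auto simp: F_def u_def)
    have le: "q k x y \<le> 2 * \<beta> * u / (a * 2 ^ k)" for k
      using lip[of k] xy \<open>0 < \<beta>\<close> a(1)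
      by (simp add: lipschitz_quasipartition_pmf_iff q_def u_def finite_pairs_def)
    have one: "q k x y = 1" if "a * 2 ^ k < u" for k
    proof -
      have "(x, y) \<notin> P" if "P \<in> set_pmf (p k)" for P
        using bdd[OF that] X(3) \<open>a * 2 ^ k < u\<close> a(1)
        by (auto simp: bounded_quasipartition_of_def)
      then show ?thesis
        by (simp add: q_def measure_pmf.prob_eq_1 AE_measure_pmf_iff)
    qed
    \<comment> \<open>By the choice of \<open>N\<close>, such a scale is at least
      \<open>2 * card X ^ 4 * u\<close>, so padding keeps the pair uncut.\<close>
    have zero: "q k x y = 0" if "2 ^ N * u \<le> a * 2 ^ k" for k
    proof -
      have "2 * real (card X) ^ 4 * u \<le> 2 ^ N * u"
        using N(1) Fpos[OF uF] by (intro mult_right_mono) auto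
      then have "2 * real (card X) ^ 4 * u \<le> a * 2 ^ k"
        using that by linarith
      then have "u \<le> a * 2 ^ k / (2 * real (card X) ^ 4)"
        using card by (simp add: field_simps)
      then have "(x, y) \<in> P" if "P \<in> set_pmf (p k)" for P
        using pad[OF that] X by (auto simp: pads_def ennreal_leI)
      then show ?thesis
        by (auto simp: q_def measure_pmf_zero_iff)
    qed
    have "0 \<le> q k x y" for k
      by (simp add: q_def)
    from multiscale_sum_bounds[OF a(1) a(2)[OF uF] K[OF uF], of "\<lambda>k. q k x y", OF this le one zero]
    show ?thesis
      by (simp add: u_def)
  qed
  have "has_distortion_on (finite_pairs X d) d (combination_dist m \<alpha> \<delta>) (4 * (2 + real N) * \<beta>)"
    unfolding has_distortion_on_def
  \<comment> \<open>The scaling factor combines the lower bound \<open>u / 2\<close> with the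
    normalisation by \<open>S\<close>.\<close>
  proof (intro exI[of _ "1 / (2 * S)"] conjI ballI, safe)
    show "0 < 1 / (2 * S)"
      using S by simp
    fix x y assume xy: "(x, y) \<in> finite_pairs X d"
    define u where "u = enn2real (d x y)"
    have u: "d x y = ennreal u" "0 \<le> u"
      using xy by (auto simp: finite_pairs_def u_def)
    have "1 / (2 * S) * u \<le> combination_dist m \<alpha> \<delta> x y"
      using main[OF xy] S by (simp add: cd' u_def field_simps)
    then show "ennreal (1 / (2 * S)) * d x y \<le> ennreal (combination_dist m \<alpha> \<delta> x y)"
      using S u by (simp add: ennreal_leI flip: ennreal_mult)
    have "combination_dist m \<alpha> \<delta> x y \<le> 4 * (2 + real N) * \<beta> * (1 / (2 * S)) * u"
      using main[OF xy] S by (simp add: cd' u_def field_simps)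
    then show "ennreal (combination_dist m \<alpha> \<delta> x y) \<le>
        ennreal (4 * (2 + real N) * \<beta> * (1 / (2 * S))) * d x y"
      using S u \<open>0 < \<beta>\<close> by (simp add: ennreal_leI flip: ennreal_mult)
  qed
  \<comment> \<open>The 4 is a factor 2 from the lower bound \<open>u / 2\<close> times a factor 2
    from the constant \<open>2 * \<beta>\<close>; with the 8 bounding \<open>2 + real N\<close> this
    makes 32.\<close>
  moreover have "4 * (2 + real N) * \<beta> \<le> 32 / ln 2 * \<beta> * ln (real (card X))"
    using mult_left_mono[OF N(2), of "4 * \<beta>"] \<open>0 < \<beta>\<close> by (simp add: mult_ac)
  ultimately show "\<exists>m \<alpha> \<delta> D. convex_combination_01 X m \<alpha> \<delta> \<and>
       D \<le> 32 / ln 2 * \<beta> * ln (real (card X)) \<and>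
       has_distortion_on (finite_pairs X d) d (combination_dist m \<alpha> \<delta>) D"
    using cc by blast
qed simp

end
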